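(* Let $\lambda\in(\frac12,1)$. Consider majority processes, and separately minority processes, under the proportional switching rule with parameter $\lambda$, where the initial coloring is uniform random (each node independently white or black with probability $\frac12$). Then for any graph on $n$ nodes, with high probability over the initial coloring, the stabilization time is $O(n\log n)$; that is, w.h.p. every valid sequence of switching steps starting from the initial coloring has length $O(n\log n)$.
   Context: Graphs are simple, unweighted and undirected with $n$ nodes; $N(v)$ is the neighborhood of $v$ and $d_v=|N(v)|$. The conflicting neighbors $N_c(v)$ of $v$ are: in a majority process, the neighbors with color different from $v$; in a minority process, the neighbors with the same color as $v$. Under proportional switching with parameter $\lambda$, $v$ is switchable if $|N_c(v)|\ge\frac{1+\lambda}{2}d_v$. The process is sequential: in each step exactly one switchable node changes to the opposite color, until no node is switchable; the stabilization time is the number of steps under the worst-case (adversarial) choice of switching order. An event holds with high probability if it holds with probability at least $1-O(n^{-c})$ for some constant $c>0$.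
   Formalization: Isolated nodes are taken never to be switchable; under the literal rule a node with d_v = 0 satisfies 0 ≥ 0 and could switch forever, so the claim would fail for graphs with isolated nodes. *)

theory Defs
  imports
    "HOL-Probability.Probability"
    "HOL-Library.Landau_Symbols"
    "HOL-Library.Extended_Nat"
    "Graph_Theory.Pair_Digraph"
begin

text \<open>
  A finite simple undirected graph is a \<^locale>\<open>pair_graph\<close>: its arc relation
  is finite, symmetric and loop-free on a finite vertex set.
\<close>

definition nbrs :: "'v pair_pre_digraph \<Rightarrow> 'v \<Rightarrow> 'v set" where
  "nbrs G v = {u. (v, u) \<in> parcs G}"

definition deg :: "'v pair_pre_digraph \<Rightarrow> 'v \<Rightarrow> nat" where
  "deg G v = card (nbrs G v)"

text \<open>The two colors are encoded as Booleans, so negation is the opposite color.\<close>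

type_synonym 'v coloring = "'v \<Rightarrow> bool"

datatype process = Majority | Minority

fun conflict_nbrs :: "process \<Rightarrow> 'v pair_pre_digraph \<Rightarrow> 'v coloring \<Rightarrow> 'v \<Rightarrow> 'v set" where
  "conflict_nbrs Majority G c v = {u \<in> nbrs G v. c u \<noteq> c v}"
| "conflict_nbrs Minority G c v = {u \<in> nbrs G v. c u = c v}"

text \<open>
  The condition \<^term>\<open>deg G v > 0\<close> only concerns isolated nodes: for these the
  threshold inequality reads \<open>0 \<ge> 0\<close>, so without this condition they could be
  switched forever and no process on a graph with an isolated node would ever stabilize.
\<close>

definition switchable ::
  "process \<Rightarrow> real \<Rightarrow> 'v pair_pre_digraph \<Rightarrow> 'v coloring \<Rightarrow> 'v \<Rightarrow> bool" where
  "switchable P lam G c v \<longleftrightarrow>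
     v \<in> pverts G \<and> deg G v > 0 \<and>
     real (card (conflict_nbrs P G c v)) \<ge> (1 + lam) / 2 * real (deg G v)"

definition switch :: "'v coloring \<Rightarrow> 'v \<Rightarrow> 'v coloring" where
  "switch c v = c(v := \<not> c v)"

fun valid_switches ::
  "process \<Rightarrow> real \<Rightarrow> 'v pair_pre_digraph \<Rightarrow> 'v coloring \<Rightarrow> 'v list \<Rightarrow> bool" where
  "valid_switches P lam G c [] \<longleftrightarrow> True"
| "valid_switches P lam G c (v # vs) \<longleftrightarrow>
     switchable P lam G c v \<and> valid_switches P lam G (switch c v) vs"

text \<open>
  The supremum ranges over all valid finite sequences, not only those that end in a stable
  coloring. Prefixes of a longer run do not change its value, and a run that never stabilizes
  makes it infinite.
\<close>

definition stabilization_time ::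
  "process \<Rightarrow> real \<Rightarrow> 'v pair_pre_digraph \<Rightarrow> 'v coloring \<Rightarrow> enat" where
  "stabilization_time P lam G c = (SUP vs \<in> {vs. valid_switches P lam G c vs}. enat (length vs))"

lemma stabilization_time_le_iff:
  "stabilization_time P lam G c \<le> enat t \<longleftrightarrow>
     (\<forall>vs. valid_switches P lam G c vs \<longrightarrow> length vs \<le> t)"
  by (auto simp: stabilization_time_def SUP_le_iff)

text \<open>Outside the vertex set the coloring has the irrelevant default value \<^term>\<open>False\<close>.\<close>

definition random_coloring :: "'v pair_pre_digraph \<Rightarrow> 'v coloring pmf" where
  "random_coloring G = Pi_pmf (pverts G) False (\<lambda>_. bernoulli_pmf (1 / 2))"

end

theory Submission
  imports Defs
begin

text \<open>
  A switch at \<open>v\<close> removes at least \<open>\<lambda> d\<^sub>v\<close> conflicting edges, all of them incident to the set \<open>S\<close>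
  of nodes that ever switch, so \<open>\<lambda> D\<close> is at most the number of initial conflicting edges
  incident to \<open>S\<close>, where \<open>D\<close> is the sum of the degrees along the switching sequence.
  By Hoeffding's inequality, with high probability every node with \<open>d\<^sub>v \<ge> K ln n\<close> starts with at
  most \<open>(1/2 + \<epsilon>) d\<^sub>v\<close> conflicting neighbors; the other nodes have at most \<open>K ln n\<close> of them anyway.
  Since every node of \<open>S\<close> occurs in the sequence, \<open>\<lambda> D \<le> (1/2 + \<epsilon>) D + K n ln n\<close>. As \<open>\<lambda> > 1/2\<close>,
  this bounds \<open>D\<close>, and with it the number of steps, by \<open>O(n ln n)\<close>.
\<close>

text \<open>Every conflicting edge incident to \<open>S\<close> is counted as two arcs, one per
  direction, hence the factors 2 below. With \<open>S\<close> fixed, the cardinality serves as a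
  potential.\<close>

definition conflict_arcs ::
  "process \<Rightarrow> 'v pair_pre_digraph \<Rightarrow> 'v set \<Rightarrow> 'v coloring \<Rightarrow> ('v \<times> 'v) set" where
  "conflict_arcs P G S c = {(u, w). (u \<in> S \<or> w \<in> S) \<and> w \<in> conflict_nbrs P G c u}"

lemma conflict_nbrs_subset: "conflict_nbrs P G c v \<subseteq> nbrs G v"
  by (cases P) auto

context pair_graph
begin

section \<open>Neighborhoods and conflicts in a simple graph\<close>

lemma nbrs_subset_verts: "nbrs G v \<subseteq> pverts G"
  using arc_snd_in_verts by (fastforce simp: nbrs_def)

lemma finite_nbrs [simp]: "finite (nbrs G v)"
  by (rule finite_subset[OF nbrs_subset_verts]) simp

lemma not_self_nbr: "v \<notin> nbrs G v"
  using no_loops' by (auto simp: nbrs_def)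

lemma nbrs_sym: "u \<in> nbrs G v \<longleftrightarrow> v \<in> nbrs G u"
  by (auto simp: nbrs_def intro: arcs_symmetric)

lemma finite_conflict_nbrs [simp]: "finite (conflict_nbrs P G c v)"
  by (rule finite_subset[OF conflict_nbrs_subset]) simp

lemma conflict_nbrs_sym: "u \<in> conflict_nbrs P G c v \<longleftrightarrow> v \<in> conflict_nbrs P G c u"
  by (cases P) (auto simp: nbrs_sym[of u v])

lemma card_conflict_nbrs_le_deg: "card (conflict_nbrs P G c v) \<le> deg G v"
  unfolding deg_def by (intro card_mono conflict_nbrs_subset) simp

lemma card_conflict_nbrs_switch:
  "card (conflict_nbrs P G (switch c v) v) = deg G v - card (conflict_nbrs P G c v)"
proof -
  have "conflict_nbrs P G (switch c v) v = nbrs G v - conflict_nbrs P G c v"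
    using not_self_nbr[of v] by (cases P) (auto simp: switch_def)
  then show ?thesis
    by (simp add: card_Diff_subset conflict_nbrs_subset deg_def)
qed

section \<open>The conflict potential and its decrease\<close>

lemma finite_conflict_arcs [simp]: "finite (conflict_arcs P G S c)"
proof (rule finite_subset)
  show "conflict_arcs P G S c \<subseteq> parcs G"
    using conflict_nbrs_subset by (fastforce simp: conflict_arcs_def nbrs_def)
qed simp

text \<open>Separates the arcs at \<open>v\<close>, the only ones that a switch at \<open>v\<close>
  affects. The arcs leaving and entering \<open>v\<close> are disjoint copies of the conflicting
  neighbors, as there are no loops.\<close>

lemma card_conflict_arcs_split:
  assumes "v \<in> S"
  shows "card (conflict_arcs P G S c) = 2 * card (conflict_nbrs P G c v) +
           card {(u, w) \<in> conflict_arcs P G S c. u \<noteq> v \<and> w \<noteq> v}"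
proof -
  define N where "N = conflict_nbrs P G c v"
  define R where "R = {(u, w) \<in> conflict_arcs P G S c. u \<noteq> v \<and> w \<noteq> v}"
  have fin: "finite N" "finite R"
    unfolding N_def R_def by (auto intro: finite_subset[OF _ finite_conflict_arcs])
  have v: "v \<notin> N"
    unfolding N_def using conflict_nbrs_subset not_self_nbr by fast
  have "conflict_arcs P G S c = Pair v ` N \<union> (\<lambda>u. (u, v)) ` N \<union> R"
    using assms conflict_nbrs_sym[of v P c] unfolding N_def R_def conflict_arcs_def by auto
  moreover have "(Pair v ` N \<union> (\<lambda>u. (u, v)) ` N) \<inter> R = {}" "Pair v ` N \<inter> (\<lambda>u. (u, v)) ` N = {}"
    using v by (auto simp: R_def)
  moreover have "card (Pair v ` N) = card N" "card ((\<lambda>u. (u, v)) ` N) = card N"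
    by (auto intro!: card_image inj_onI)
  ultimately have "card (conflict_arcs P G S c) = 2 * card N + card R"
    using fin by (simp add: card_Un_disjoint)
  then show ?thesis
    by (simp only: N_def R_def)
qed

text \<open>If \<open>v\<close> has degree \<open>d\<close> and \<open>k\<close> conflicting
  neighbors, the switch leaves \<open>d - k\<close> of them, so the potential drops by
  \<open>2 * (2 * k - d)\<close>. The switching threshold is exactly what makes this at least
  \<open>2 * lam * d\<close>.\<close>

lemma card_conflict_arcs_switch:
  assumes "v \<in> S" and "switchable P lam G c v"
  shows "real (card (conflict_arcs P G S (switch c v))) + 2 * lam * real (deg G v)
           \<le> real (card (conflict_arcs P G S c))"
proof -
  have "{(u, w) \<in> conflict_arcs P G S (switch c v). u \<noteq> v \<and> w \<noteq> v} =
        {(u, w) \<in> conflict_arcs P G S c. u \<noteq> v \<and> w \<noteq> v}"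
    by (cases P) (auto simp: conflict_arcs_def switch_def)
  then show ?thesis
    using assms(2) card_conflict_nbrs_le_deg[of P c v]
    by (simp add: card_conflict_arcs_split[OF assms(1)] card_conflict_nbrs_switch
        switchable_def of_nat_diff field_simps)
qed

text \<open>The drops telescope and the potential stays nonnegative. \<open>S\<close> is a free
  superset of \<open>set vs\<close> so that the potential remains the same one when the induction
  passes to the tail.\<close>

lemma valid_switches_conflict_arcs:
  assumes "valid_switches P lam G c vs" and "set vs \<subseteq> S"
  shows "2 * lam * real (\<Sum>v\<leftarrow>vs. deg G v) \<le> real (card (conflict_arcs P G S c))"
  using assms
proof (induction vs arbitrary: c)
  case (Cons v vs)
  have "2 * lam * real (\<Sum>v\<leftarrow>vs. deg G v) \<le> real (card (conflict_arcs P G S (switch c v)))"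
    using Cons.prems by (intro Cons.IH) simp_all
  then show ?case
    using card_conflict_arcs_switch[of v S P lam c] Cons.prems by (simp add: algebra_simps)
qed simp

lemma valid_switches_switched:
  assumes "valid_switches P lam G c vs" and "v \<in> set vs"
  shows "v \<in> pverts G" and "deg G v > 0"
  using assms by (induction vs arbitrary: c) (auto simp: switchable_def)

section \<open>From initial conflicts to a bound on the number of steps\<close>

lemma card_conflict_arcs_le:
  assumes "finite S"
  shows "card (conflict_arcs P G S c) \<le> 2 * (\<Sum>v\<in>S. card (conflict_nbrs P G c v))"
proof -
  define A where "A = Sigma S (conflict_nbrs P G c)"
  have fin: "finite A"
    using assms by (auto simp: A_def)
  have "conflict_arcs P G S c \<subseteq> A \<union> prod.swap ` A"
    using conflict_nbrs_sym[of _ P c] by (force simp: conflict_arcs_def A_def)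
  then have "card (conflict_arcs P G S c) \<le> card (A \<union> prod.swap ` A)"
    using fin by (intro card_mono) auto
  also have "\<dots> \<le> card A + card (prod.swap ` A)"
    by (rule card_Un_le)
  also have "\<dots> \<le> 2 * card A"
    using card_image_le[OF fin, of prod.swap] by simp
  finally show ?thesis
    using assms by (simp add: A_def)
qed

lemma length_valid_switches_le:
  assumes conf: "\<And>v. v \<in> pverts G \<Longrightarrow> real (card (conflict_nbrs P G c v)) \<le> a * real (deg G v) + b"
    and "0 \<le> a" and "a < lam" and "0 \<le> b" and vs: "valid_switches P lam G c vs"
  shows "real (length vs) \<le> b * real (card (pverts G)) / (lam - a)"
proof -
  define D where "D = (\<Sum>v\<leftarrow>vs. deg G v)"
  have S: "set vs \<subseteq> pverts G"
    using valid_switches_switched(1)[OF vs] by auto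
  \<comment> \<open>Each switched node is counted in \<open>D\<close> with multiplicity at least
    one.\<close>
  have "(\<Sum>v\<in>set vs. deg G v) \<le> D"
    unfolding D_def sum_list_map_eq_sum_count
    by (intro sum_mono) (simp add: Suc_le_eq count_list_0_iff flip: neq0_conv)
  moreover have "card (set vs) \<le> card (pverts G)"
    using S by (intro card_mono) simp_all
  moreover have "2 * lam * real D \<le> 2 * (\<Sum>v\<in>set vs. real (card (conflict_nbrs P G c v)))"
    using valid_switches_conflict_arcs[OF vs order.refl] card_conflict_arcs_le[of "set vs" P c]
    unfolding D_def by (simp flip: of_nat_sum)
  moreover have "(\<Sum>v\<in>set vs. real (card (conflict_nbrs P G c v)))
      \<le> (\<Sum>v\<in>set vs. a * real (deg G v) + b)"
    using S by (intro sum_mono conf) auto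
  moreover have "(\<Sum>v\<in>set vs. a * real (deg G v) + b)
      = a * real (\<Sum>v\<in>set vs. deg G v) + b * real (card (set vs))"
    by (simp add: sum.distrib flip: sum_distrib_left)
  ultimately have "lam * real D \<le> a * real D + b * real (card (pverts G))"
    using \<open>0 \<le> a\<close> \<open>0 \<le> b\<close>
      mult_left_mono[of "real (\<Sum>v\<in>set vs. deg G v)" "real D" a]
      mult_left_mono[of "real (card (set vs))" "real (card (pverts G))" b]
    by linarith
  \<comment> \<open>Switched nodes have positive degree, so each step contributes at least 1 to
    \<open>D\<close>.\<close>
  moreover have "length vs \<le> D"
  proof -
    have "(\<Sum>v\<leftarrow>vs. 1) \<le> D"
      unfolding D_def using valid_switches_switched(2)[OF vs]
      by (intro sum_list_mono) (simp add: Suc_le_eq)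
    then show ?thesis by (simp add: sum_list_triv)
  qed
  ultimately have "(lam - a) * real (length vs) \<le> b * real (card (pverts G))"
    using \<open>a < lam\<close> mult_left_mono[of "real (length vs)" "real D" "lam - a"]
    by (simp add: algebra_simps)
  then show ?thesis
    using \<open>a < lam\<close> by (simp add: field_simps)
qed

section \<open>Concentration of the initial coloring\<close>

text \<open>The conflicting neighbors form one of the two color classes of the neighborhood. A
  two-sided bound therefore covers both processes and both colors of \<open>v\<close>, without
  conditioning on \<open>c v\<close>.\<close>

lemma card_conflict_nbrs_le_of_balanced:
  assumes "\<bar>real (card {u \<in> nbrs G v. c u}) - real (deg G v) / 2\<bar> \<le> e"
  shows "real (card (conflict_nbrs P G c v)) \<le> real (deg G v) / 2 + e"
proof -
  have "{u \<in> nbrs G v. \<not> c u} = nbrs G v - {u \<in> nbrs G v. c u}"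
    by auto
  then have "real (card {u \<in> nbrs G v. \<not> c u}) = real (deg G v) - real (card {u \<in> nbrs G v. c u})"
    by (simp add: card_Diff_subset deg_def of_nat_diff card_mono)
  moreover have "conflict_nbrs P G c v \<in> {{u \<in> nbrs G v. c u}, {u \<in> nbrs G v. \<not> c u}}"
    by (cases P; cases "c v") auto
  ultimately show ?thesis
    using assms by auto
qed

lemma prob_unbalanced_le:
  assumes "0 \<le> e"
  shows "measure_pmf.prob (random_coloring G)
           {c. \<bar>real (card {u \<in> nbrs G v. c u}) - real (deg G v) / 2\<bar> > e * real (deg G v)}
         \<le> 2 * exp (- 2 * real (deg G v) * e\<^sup>2)"
proof (cases "deg G v = 0")
  case True
  then have "nbrs G v = {}" by (simp add: deg_def)
  then show ?thesis using True by simp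
next
  case False
  interpret binomial_distribution "deg G v" "1 / 2"
    by unfold_locales simp
  have "binomial_pmf (deg G v) (1 / 2) =
        map_pmf (\<lambda>c. card {u \<in> nbrs G v. c u}) (Pi_pmf (nbrs G v) False (\<lambda>_. bernoulli_pmf (1 / 2)))"
    by (rule binomial_pmf_altdef') (simp_all add: deg_def)
  \<comment> \<open>The count depends only on the colors in \<open>nbrs G v\<close>, and restricting
    the random coloring to this set gives the product measure there.\<close>
  also have "\<dots> = map_pmf (\<lambda>c. card {u \<in> nbrs G v. c u}) (random_coloring G)"
    unfolding random_coloring_def
    by (subst Pi_pmf_subset[OF _ nbrs_subset_verts])
      (auto simp: map_pmf_comp intro!: map_pmf_cong arg_cong[where f = card])
  finally have bin: "binomial_pmf (deg G v) (1 / 2) =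
      map_pmf (\<lambda>c. card {u \<in> nbrs G v. c u}) (random_coloring G)" .
  have "measure_pmf.prob (random_coloring G)
          {c. \<bar>real (card {u \<in> nbrs G v. c u}) - real (deg G v) / 2\<bar> > e * real (deg G v)}
        \<le> measure_pmf.prob (binomial_pmf (deg G v) (1 / 2))
            {x. \<bar>real x - real (deg G v) * (1 / 2)\<bar> \<ge> e * real (deg G v)}"
    unfolding bin by (auto intro!: measure_pmf.finite_measure_mono)
  also have "\<dots> \<le> 2 * exp (- 2 * (e * real (deg G v))\<^sup>2 / real (deg G v))"
    using False assms by (intro prob_abs_ge) auto
  also have "- 2 * (e * real (deg G v))\<^sup>2 / real (deg G v) = - 2 * real (deg G v) * e\<^sup>2"
    using False by (simp add: power2_eq_square)
  finally show ?thesis .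
qed

lemma prob_stabilization_time_ge:
  fixes lam e :: real
  defines "n \<equiv> card (pverts G)"
  assumes e: "0 < e" "1 / 2 + e < lam"
  shows "measure_pmf.prob (random_coloring G)
           {c. stabilization_time P lam G c
             \<le> enat (nat \<lfloor>ln (real n) / e\<^sup>2 * real n / (lam - (1 / 2 + e))\<rfloor>)} \<ge> 1 - 2 / real n"
\<comment> \<open>For \<open>n = 0\<close> division by zero turns the lower bound into 1, so every
  coloring has to satisfy the claim; it does, since no node can switch.\<close>
proof (cases "n = 0")
  case True
  then have "pverts G = {}" by (simp add: n_def)
  then have "stabilization_time P lam G c \<le> enat t" for c t
    unfolding stabilization_time_le_iff using valid_switches_switched(1)
    by (metis empty_iff le0 list.set_intros(1) list.size(3) neq_Nil_conv)
  then show ?thesis by simp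
next
  case False
  \<comment> \<open>At degree \<open>b\<close> Hoeffding's bound equals \<open>2 / n^2\<close>, so a
    union bound over at most \<open>n\<close> nodes of degree at least \<open>b\<close> leaves
    failure probability \<open>2 / n\<close>.\<close>
  define b where "b = ln (real n) / e\<^sup>2"
  have "0 \<le> b"
    using False by (simp add: b_def)
  define B where "B v =
    {c. \<bar>real (card {u \<in> nbrs G v. c u}) - real (deg G v) / 2\<bar> > e * real (deg G v)}" for v
  define H where "H = {v \<in> pverts G. real (deg G v) \<ge> b}"
  have good: "stabilization_time P lam G c \<le> enat (nat \<lfloor>b * real n / (lam - (1 / 2 + e))\<rfloor>)"
    if c: "c \<notin> (\<Union>v\<in>H. B v)" for c
    unfolding stabilization_time_le_iff
  proof (intro allI impI)
    fix vs assume vs: "valid_switches P lam G c vs"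
    \<comment> \<open>One inequality for all degrees: balance gives the first summand for nodes in
      \<open>H\<close>, while the others have degree below \<open>b\<close>.\<close>
    have "real (card (conflict_nbrs P G c v)) \<le> (1 / 2 + e) * real (deg G v) + b"
      if "v \<in> pverts G" for v
    proof (cases "v \<in> H")
      case True
      then show ?thesis
        using c card_conflict_nbrs_le_of_balanced[of v c "e * real (deg G v)" P] \<open>0 \<le> b\<close>
        by (auto simp: B_def not_less algebra_simps)
    next
      case False
      have "0 \<le> (1 / 2 + e) * real (deg G v)"
        using e by simp
      then show ?thesis
        using False that card_conflict_nbrs_le_deg[of P c v] by (simp add: H_def)
    qed
    from length_valid_switches_le[OF this _ _ \<open>0 \<le> b\<close> vs]
    have "real (length vs) \<le> b * real n / (lam - (1 / 2 + e))"
      using e by (simp add: n_def)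
    then show "length vs \<le> nat \<lfloor>b * real n / (lam - (1 / 2 + e))\<rfloor>"
      by (simp add: le_nat_floor)
  qed
  have "measure_pmf.prob (random_coloring G) (\<Union>v\<in>H. B v)
      \<le> (\<Sum>v\<in>H. measure_pmf.prob (random_coloring G) (B v))"
    by (intro measure_pmf.finite_measure_subadditive_finite) (auto simp: H_def)
  also have "\<dots> \<le> (\<Sum>v\<in>H. 2 / (real n)\<^sup>2)"
  proof (rule sum_mono)
    fix v assume "v \<in> H"
    then have "ln (real n) \<le> real (deg G v) * e\<^sup>2"
      using e by (simp add: H_def b_def field_simps)
    then have "2 * exp (- 2 * real (deg G v) * e\<^sup>2) \<le> 2 * exp (- (2 * ln (real n)))"
      by simp
    also have "\<dots> = 2 / (real n)\<^sup>2"
      using False by (simp add: exp_minus exp_double field_simps)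
    finally show "measure_pmf.prob (random_coloring G) (B v) \<le> 2 / (real n)\<^sup>2"
      using prob_unbalanced_le[of e v] e unfolding B_def by linarith
  qed
  also have "\<dots> \<le> real n * (2 / (real n)\<^sup>2)"
    unfolding sum_constant n_def
    by (intro mult_right_mono of_nat_mono card_mono) (auto simp: H_def)
  also have "\<dots> = 2 / real n"
    by (simp add: power2_eq_square)
  finally have "1 - 2 / real n \<le> measure_pmf.prob (random_coloring G) (- (\<Union>v\<in>H. B v))"
    using measure_pmf.prob_compl[of "\<Union>v\<in>H. B v" "random_coloring G"] by (simp add: Compl_eq_Diff_UNIV)
  also have "\<dots> \<le> measure_pmf.prob (random_coloring G)
      {c. stabilization_time P lam G c \<le> enat (nat \<lfloor>b * real n / (lam - (1 / 2 + e))\<rfloor>)}"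
    using good by (intro measure_pmf.finite_measure_mono) auto
  finally show ?thesis
    by (simp add: b_def)
qed

end

theorem theorem8:
  fixes lam :: real and P :: process
  assumes "1 / 2 < lam" and "lam < 1"
  shows "\<exists>(T :: nat \<Rightarrow> nat) (err :: nat \<Rightarrow> real) (c :: real).
           (\<lambda>n. real (T n)) \<in> O(\<lambda>n. real n * ln (real n)) \<and>
           c > 0 \<and> err \<in> O(\<lambda>n. real n powr (- c)) \<and>
           (\<forall>(G :: 'v pair_pre_digraph) n. pair_graph G \<longrightarrow> card (pverts G) = n \<longrightarrow>
              measure_pmf.prob (random_coloring G)
                {col. stabilization_time P lam G col \<le> enat (T n)} \<ge> 1 - err n)"
proof -
  \<comment> \<open>This puts \<open>1 / 2 + e\<close> midway between \<open>1 / 2\<close> and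
    \<open>lam\<close>. Neither \<open>e\<close> nor \<open>T\<close> depends on the graph, so the
    bound is uniform over all graphs on \<open>n\<close> nodes.\<close>
  define e where "e = (lam - 1 / 2) / 2"
  have e: "0 < e" "1 / 2 + e < lam"
    using assms by (simp_all add: e_def field_simps)
  define T where "T n = nat \<lfloor>ln (real n) / e\<^sup>2 * real n / (lam - (1 / 2 + e))\<rfloor>" for n :: nat
  have "(\<lambda>n. real (T n)) \<in> O(\<lambda>n. real n * ln (real n))"
  proof (rule bigoI)
    show "\<forall>\<^sub>F n in sequentially. norm (real (T n))
        \<le> 1 / (e\<^sup>2 * (lam - (1 / 2 + e))) * norm (real n * ln (real n))"
      \<comment> \<open>For \<open>n \<ge> 1\<close> the logarithm is nonnegative, so passing to
        \<open>nat\<close> of the floor can only decrease the value.\<close>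
      using eventually_ge_at_top[of 1]
    proof eventually_elim
      case (elim n)
      then have "0 \<le> ln (real n) / e\<^sup>2 * real n / (lam - (1 / 2 + e))"
        using e by simp
      from of_nat_floor[OF this] show ?case
        using elim by (simp add: T_def mult_ac abs_mult)
    qed
  qed
  moreover have "(\<lambda>n. 2 / real n) \<in> O(\<lambda>n. real n powr (- 1))"
    by (intro bigoI[of _ 2]) (simp add: powr_minus divide_inverse)
  moreover have "1 - 2 / real n \<le> measure_pmf.prob (random_coloring G)
      {col. stabilization_time P lam G col \<le> enat (T n)}"
    if "pair_graph G" and "card (pverts G) = n" for G :: "'v pair_pre_digraph" and n
    using pair_graph.prob_stabilization_time_ge[OF that(1) e, of P] that(2) by (simp add: T_def)
  ultimately show ?thesis
    by (intro exI[of _ T] exI[of _ "\<lambda>n. 2 / real n"] exI[of _ 1]) auto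
qed

end
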